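(* Let $R$ be a Dedekind-finite unital $*$-ring and let $a,w,v\in R$. Suppose $a$ is regular and let $a^-$ be an inner inverse of $a$. Then the following conditions are equivalent: (i) $a$ is both $w$-core invertible and dual $v$-core invertible. (ii) $wav$ is invertible along $a$ and $a$ is Moore-Penrose invertible. (iii) $vaw$ is invertible along $a$ and $a$ is Moore-Penrose invertible. (iv) $u=awavaa^*+1-aa^{-}\in R^{-1}$. (v) $r=avawaa^*+1-aa^{-}\in R^{-1}$. (vi) $s=wavaa^*a+1-a^{-}a\in R^{-1}$. (vii) $t=vawaa^*a+1-a^{-}a\in R^{-1}$. In this case, the $w$-core inverse of $a$ equals $avaa^*as^{-1}(u^{-1}awava)^*$ and the dual $v$-core inverse of $a$ equals $(u^{-1}awava)^*awaa^*at^{-1}$.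
   Context: A unital $*$-ring is an associative ring $R$ with identity $1$ and a map $*$ satisfying $(x^* )^*=x$, $(xy)^*=y^*x^*$ and $(x+y)^*=x^*+y^*$ for all $x,y\in R$. $R^{-1}$ is the group of invertible elements of $R$. $R$ is Dedekind-finite if $xy=1$ implies $yx=1$ for all $x,y\in R$. For $a,w\in R$, $a$ is $w$-core invertible if there exists $x\in R$ with $awx^2=x$, $xawa=a$ and $(awx)^*=awx$. Such an $x$ is unique if it exists and is called the $w$-core inverse of $a$. For $a,v\in R$, $a$ is dual $v$-core invertible if there exists $y\in R$ with $avay=a$, $y^2va=y$ and $(yva)^*=yva$. Such a $y$ is unique if it exists and is called the dual $v$-core inverse of $a$. For $c,d\in R$, $c$ is invertible along $d$ if there exists $b\in R$ with $bcd=d=dcb$ and $b\in dR\cap Rd$. An element $a$ is regular if it has an inner inverse, i.e. some $x\in R$ with $axa=a$. It is Moore-Penrose invertible if there is $x\in R$ with $axa=a$, $xax=x$, $(ax)^*=ax$, $(xa)^*=xa$. *)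

theory Defs
  imports Main
begin

text \<open>
  The class is built on \<^class>\<open>ring\<close> and \<^class>\<open>monoid_mult\<close> rather than on \<^class>\<open>ring_1\<close>,
  because the latter requires \<open>0 \<noteq> 1\<close>, which is not part of the definition of a unital ring here.
\<close>

class star_ring = ring + monoid_mult +
  fixes star :: "'a \<Rightarrow> 'a"  ("(_\<^sup>\<star>)" [1000] 999)
  assumes star_star: "(x\<^sup>\<star>)\<^sup>\<star> = x"
    and star_mult: "(x * y)\<^sup>\<star> = y\<^sup>\<star> * x\<^sup>\<star>"
    and star_add: "(x + y)\<^sup>\<star> = x\<^sup>\<star> + y\<^sup>\<star>"

definition dedekind_finite :: "'a::monoid_mult itself \<Rightarrow> bool" where
  "dedekind_finite _ \<longleftrightarrow> (\<forall>x y :: 'a. x * y = 1 \<longrightarrow> y * x = 1)"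

definition units :: "'a::monoid_mult set" where
  "units = {x. \<exists>y. x * y = 1 \<and> y * x = 1}"

definition unit_inv :: "'a::monoid_mult \<Rightarrow> 'a" where
  "unit_inv x = (THE y. x * y = 1 \<and> y * x = 1)"

definition is_inner_inverse :: "'a::semigroup_mult \<Rightarrow> 'a \<Rightarrow> bool" where
  "is_inner_inverse a x \<longleftrightarrow> a * x * a = a"

definition regular :: "'a::semigroup_mult \<Rightarrow> bool" where
  "regular a \<longleftrightarrow> (\<exists>x. is_inner_inverse a x)"

definition moore_penrose_invertible :: "'a::star_ring \<Rightarrow> bool" where
  "moore_penrose_invertible a \<longleftrightarrow>
    (\<exists>x. a * x * a = a \<and> x * a * x = x \<and> (a * x)\<^sup>\<star> = a * x \<and> (x * a)\<^sup>\<star> = x * a)"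

definition invertible_along :: "'a::semigroup_mult \<Rightarrow> 'a \<Rightarrow> bool" where
  "invertible_along c d \<longleftrightarrow>
    (\<exists>b. b * c * d = d \<and> d = d * c * b \<and> b \<in> range (\<lambda>z. d * z) \<inter> range (\<lambda>z. z * d))"

definition is_core_inverse :: "'a::star_ring \<Rightarrow> 'a \<Rightarrow> 'a \<Rightarrow> bool" where
  "is_core_inverse w a x \<longleftrightarrow>
    a * w * x^2 = x \<and> x * a * w * a = a \<and> (a * w * x)\<^sup>\<star> = a * w * x"

definition core_invertible :: "'a::star_ring \<Rightarrow> 'a \<Rightarrow> bool" where
  "core_invertible w a \<longleftrightarrow> (\<exists>x. is_core_inverse w a x)"

definition core_inverse :: "'a::star_ring \<Rightarrow> 'a \<Rightarrow> 'a" where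
  "core_inverse w a = (THE x. is_core_inverse w a x)"

definition is_dual_core_inverse :: "'a::star_ring \<Rightarrow> 'a \<Rightarrow> 'a \<Rightarrow> bool" where
  "is_dual_core_inverse v a y \<longleftrightarrow>
    a * v * a * y = a \<and> y^2 * v * a = y \<and> (y * v * a)\<^sup>\<star> = y * v * a"

definition dual_core_invertible :: "'a::star_ring \<Rightarrow> 'a \<Rightarrow> bool" where
  "dual_core_invertible v a \<longleftrightarrow> (\<exists>y. is_dual_core_inverse v a y)"

definition dual_core_inverse :: "'a::star_ring \<Rightarrow> 'a \<Rightarrow> 'a" where
  "dual_core_inverse v a = (THE y. is_dual_core_inverse v a y)"

text \<open>
  The three definite descriptions above are well defined whenever the element in question is
  invertible in the respective sense.
\<close>

lemma unit_inv_eqI: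
  fixes x y :: "'a::monoid_mult"
  assumes "x * y = 1" "y * x = 1"
  shows "unit_inv x = y"
  unfolding unit_inv_def
proof (rule the_equality)
  fix z assume "x * z = 1 \<and> z * x = 1"
  then have "z = (y * x) * z" "x * z = 1" using assms by auto
  then show "z = y" by (simp add: mult.assoc)
qed (use assms in simp)

lemma is_core_inverse_unique:
  fixes a w x x' :: "'a::star_ring"
  assumes "is_core_inverse w a x" "is_core_inverse w a x'"
  shows "x = x'"
proof -
  have e: "a * (w * (x * x)) = x" "x * (a * (w * a)) = a" "(a * (w * x))\<^sup>\<star> = a * (w * x)"
    "a * (w * (x' * x')) = x'" "x' * (a * (w * a)) = a" "(a * (w * x'))\<^sup>\<star> = a * (w * x')"
    using assms by (simp_all add: is_core_inverse_def power2_eq_square mult.assoc)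
  have p: "a * (w * x) * a = a" using e(1,2) by (metis mult.assoc)
  have p': "a * (w * x') * a = a" using e(4,5) by (metis mult.assoc)
  have 1: "a * (w * x) = (a * (w * x')) * (a * (w * x))" using p' by (metis mult.assoc)
  have 2: "a * (w * x') = (a * (w * x)) * (a * (w * x'))" using p by (metis mult.assoc)
  have eq: "a * (w * x) = a * (w * x')" using 1 2 e(3,6) by (metis star_mult)
  have "x = x * (a * (w * x))" using e(1,2) by (metis mult.assoc)
  also have "\<dots> = x * (a * (w * x'))" by (simp only: eq)
  also have "\<dots> = x'" using e(2,4) by (metis mult.assoc)
  finally show ?thesis .
qed

lemma core_inverse_eqI: "is_core_inverse w a x \<Longrightarrow> core_inverse w a = x"
  unfolding core_inverse_def by (blast intro: the_equality is_core_inverse_unique)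

lemma is_dual_core_inverse_unique:
  fixes a v y y' :: "'a::star_ring"
  assumes "is_dual_core_inverse v a y" "is_dual_core_inverse v a y'"
  shows "y = y'"
proof -
  have e: "a * (v * (a * y)) = a" "y * (y * (v * a)) = y" "(y * (v * a))\<^sup>\<star> = y * (v * a)"
    "a * (v * (a * y')) = a" "y' * (y' * (v * a)) = y'" "(y' * (v * a))\<^sup>\<star> = y' * (v * a)"
    using assms by (simp_all add: is_dual_core_inverse_def power2_eq_square mult.assoc)
  have q: "a * (y * (v * a)) = a" using e(1,2) by (metis mult.assoc)
  have q': "a * (y' * (v * a)) = a" using e(4,5) by (metis mult.assoc)
  have 1: "y * (v * a) = (y * (v * a)) * (y' * (v * a))" using q' by (metis mult.assoc)
  have 2: "y' * (v * a) = (y' * (v * a)) * (y * (v * a))" using q by (metis mult.assoc)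
  have eq: "y * (v * a) = y' * (v * a)" using 1 2 e(3,6) by (metis star_mult)
  have "y = y * (v * a) * y" using e(1,2) by (metis mult.assoc)
  also have "\<dots> = y' * (v * a) * y" by (simp only: eq)
  also have "\<dots> = y'" using e(1,5) by (metis mult.assoc)
  finally show ?thesis .
qed

lemma dual_core_inverse_eqI: "is_dual_core_inverse v a y \<Longrightarrow> dual_core_inverse v a = y"
  unfolding dual_core_inverse_def by (blast intro: the_equality is_dual_core_inverse_unique)

end

theory Submission
  imports Defs
begin

text \<open>
  Put \<open>p = aa'\<close>, an idempotent with \<open>pR = aR\<close>. The elements \<open>aw\<close>, \<open>av\<close>, \<open>aa\<^sup>\<star>\<close> act on
  \<open>aR\<close> by left multiplication, and hence give elements \<open>A, B, C\<close> of the corner ring \<open>pRp\<close>, which is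
  again Dedekind-finite. Now \<open>A\<close> is invertible iff \<open>w\<close> is invertible along \<open>a\<close>, \<open>C\<close> is invertible
  iff \<open>a\<close> is Moore-Penrose invertible, and \<open>u\<close> is a unit iff \<open>ABC\<close> is invertible. By
  Dedekind-finiteness a product in the corner is invertible iff all factors are, in whatever order,
  so all seven conditions say that \<open>A, B, C\<close> are invertible; \<open>s\<close> and \<open>t\<close> come from \<open>u\<close> and \<open>r\<close> by
  Jacobson's lemma. The element \<open>u\<inverse>awava\<close> is the inverse of \<open>a\<^sup>\<star>\<close> along \<open>a\<close>, and its adjoint is an
  inner inverse \<open>g\<close> of \<open>a\<close> with \<open>ag\<close> and \<open>ga\<close> hermitian. If \<open>b\<close> is the inverse of \<open>w\<close> (of \<open>v\<close>) along
  \<open>a\<close>, then \<open>bg\<close> (respectively \<open>gb\<close>) is the core (dual core) inverse.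
\<close>

section \<open>Units, Dedekind-finiteness and Jacobson's lemma\<close>

lemma unitsI: "x * y = 1 \<Longrightarrow> y * x = 1 \<Longrightarrow> x \<in> units"
  unfolding units_def by blast

lemma unit_inv_props:
  assumes "x \<in> units"
  shows "x * unit_inv x = 1" and "unit_inv x * x = 1"
  using assms unit_inv_eqI unfolding units_def by auto

text \<open>Used to rewrite a left multiple of \<open>a\<close> as a right multiple of
  \<open>a\<close>.\<close>

lemma unit_inv_intertwine:
  fixes x y b :: "'a::monoid_mult"
  assumes "x \<in> units" "y \<in> units" "x * b = b * y"
  shows "unit_inv x * b = b * unit_inv y"
proof -
  have "unit_inv x * b = unit_inv x * (b * y) * unit_inv y"
    using unit_inv_props(1)[OF assms(2)] by (simp add: mult.assoc)
  also have "\<dots> = (unit_inv x * x) * b * unit_inv y"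
    by (simp add: assms(3)[symmetric] mult.assoc)
  finally show ?thesis using unit_inv_props(2)[OF assms(1)] by simp
qed

lemma dedekind_finite_unitsI:
  fixes x y :: "'a::monoid_mult"
  assumes "dedekind_finite TYPE('a)" "x * y = 1"
  shows "x \<in> units" and "y \<in> units"
  using assms unfolding dedekind_finite_def units_def by blast+

lemma dedekind_finite_mult_units_iff:
  fixes x y :: "'a::monoid_mult"
  assumes df: "dedekind_finite TYPE('a)"
  shows "x * y \<in> units \<longleftrightarrow> x \<in> units \<and> y \<in> units"
proof
  assume "x * y \<in> units"
  then obtain k where k: "x * y * k = 1" "k * (x * y) = 1"
    unfolding units_def by blast
  have "x * (y * k) = 1" "k * x * y = 1" using k by (simp_all add: mult.assoc)
  then show "x \<in> units \<and> y \<in> units" using dedekind_finite_unitsI[OF df] by blast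
next
  assume "x \<in> units \<and> y \<in> units"
  then obtain k l where k: "x * k = 1" "y * l = 1"
    unfolding units_def by blast
  have "x * y * (l * k) = x * (y * l) * k" by (simp only: mult.assoc)
  then show "x * y \<in> units" using k dedekind_finite_unitsI(1)[OF df] by simp
qed

lemma Jacobson_units:
  fixes x y :: "'a::{ring,monoid_mult}"
  assumes "1 + x * y \<in> units"
  shows "1 + y * x \<in> units"
proof -
  obtain k where k: "(1 + x * y) * k = 1" "k * (1 + x * y) = 1"
    using assms unfolding units_def by blast
  have k': "k + x * (y * k) = 1" "k + k * (x * y) = 1"
    using k by (simp_all add: algebra_simps)
  \<comment> \<open>The candidate inverse \<open>1 - y * k * x\<close> is suggested by the formal
    geometric series.\<close>
  have "(1 + y * x) * (1 - y * k * x) = 1 + y * x - y * (k + x * (y * k)) * x"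
    by (simp add: algebra_simps)
  moreover have "(1 - y * k * x) * (1 + y * x) = 1 + y * x - y * (k + k * (x * y)) * x"
    by (simp add: algebra_simps)
  ultimately show ?thesis using k' by (intro unitsI[of _ "1 - y * k * x"]) simp_all
qed

lemma Jacobson_units_iff:
  fixes x y :: "'a::{ring,monoid_mult}"
  shows "1 + x * y \<in> units \<longleftrightarrow> 1 + y * x \<in> units"
  using Jacobson_units by blast

section \<open>Units in the corner of \<open>a * a'\<close>\<close>

text \<open>
  The action of \<open>az\<close> on \<open>aR\<close>, viewed in the corner of \<open>aa'\<close> and extended by the identity on the
  complementary corner.
\<close>

definition corner_map :: "'a::{ring,monoid_mult} \<Rightarrow> 'a \<Rightarrow> 'a \<Rightarrow> 'a" where
  "corner_map a a' z = a * z * a * a' + 1 - a * a'"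

context
  fixes a a' :: "'a::{ring,monoid_mult}"
  assumes inner: "a * a' * a = a"
begin

lemma inner_assoc: "a * (a' * a) = a" "a * (a' * (a * x)) = a * x"
  using inner by (simp_all flip: mult.assoc)

text \<open>The idempotent \<open>1 - a * a'\<close> kills \<open>a\<close> from the left and is
  killed by \<open>a * a'\<close>, so the cross terms vanish and the corner part is the product of
  the actions of \<open>a * z\<close> and \<open>a * z'\<close>.\<close>

lemma corner_map_mult: "corner_map a a' z * corner_map a a' z' = corner_map a a' (z * a * z')"
  unfolding corner_map_def by (simp add: algebra_simps inner_assoc)

lemma corner_map_units_iff:
  "corner_map a a' z \<in> units \<longleftrightarrow> z * a + 1 - a' * a \<in> units"
  using Jacobson_units_iff[of a "z * a * a' - a'"]
  unfolding corner_map_def by (simp add: algebra_simps inner_assoc)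

text \<open>Serves \<open>u\<close> and \<open>r\<close>, which lack the trailing factor
  \<open>a * a'\<close> of a \<open>corner_map\<close> value but have the same Jacobson
  partner.\<close>

lemma units_row_column_iff:
  "a * z + 1 - a * a' \<in> units \<longleftrightarrow> z * a + 1 - a' * a \<in> units"
  using Jacobson_units_iff[of a "z - a'"] by (simp add: algebra_simps)

text \<open>A one-sided equation suffices: \<open>a * y * a'\<close> provides a right inverse on the
  corner, and Dedekind-finiteness makes it two-sided.\<close>

lemma corner_map_unitI_right:
  assumes "dedekind_finite TYPE('a)" "a = a * z * a * y"
  shows "corner_map a a' z \<in> units"
proof (rule dedekind_finite_unitsI(1)[OF assms(1)])
  have "a * (z * (a * (y * x))) = a * x" for x
    using assms(2) by (metis mult.assoc)
  then show "corner_map a a' z * (a * y * a' + 1 - a * a') = 1"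
    unfolding corner_map_def by (simp add: algebra_simps inner_assoc)
qed

lemma corner_map_unitI_left:
  assumes "dedekind_finite TYPE('a)" "a = y * a * z * a"
  shows "corner_map a a' z \<in> units"
proof -
  have "y * (a * (z * a)) = a"
    using assms(2) by (metis mult.assoc)
  \<comment> \<open>A left inverse is found relative to the idempotent \<open>a' * a\<close>;
    Jacobson's lemma then leads back to \<open>a * a'\<close>.\<close>
  then have "(a' * y * a + 1 - a' * a) * (1 + a' * (a * z * a - a)) = 1"
    by (simp add: algebra_simps inner_assoc)
  then have "1 + a' * (a * z * a - a) \<in> units"
    by (rule dedekind_finite_unitsI(2)[OF assms(1)])
  then show ?thesis
    using Jacobson_units_iff[of a' "a * z * a - a"]
    unfolding corner_map_def by (simp add: algebra_simps)
qed

lemma corner_map_units_iff_invertible_along: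
  assumes "dedekind_finite TYPE('a)"
  shows "corner_map a a' z \<in> units \<longleftrightarrow> invertible_along z a"
proof
  assume u: "corner_map a a' z \<in> units"
  let ?u = "corner_map a a' z" and ?s = "z * a + 1 - a' * a"
  have s: "?s \<in> units" using u corner_map_units_iff by simp
  have ua: "?u * a = a * z * a" and as: "a * ?s = a * z * a"
    unfolding corner_map_def by (simp_all add: algebra_simps inner_assoc)
  \<comment> \<open>Since \<open>?u * a = a * ?s\<close>, this element also equals
    \<open>a * unit_inv ?s\<close>, which places it in both aR and Ra.\<close>
  let ?b = "unit_inv ?u * a"
  have b: "?b = a * unit_inv ?s"
    using unit_inv_intertwine[OF u s] ua as by simp
  have "?b * z * a = unit_inv ?u * (?u * a)" by (simp add: ua mult.assoc)
  then have 1: "?b * z * a = a" using unit_inv_props(2)[OF u] by (simp flip: mult.assoc)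
  have "a * z * (a * unit_inv ?s) = a * ?s * unit_inv ?s" by (simp only: as mult.assoc)
  then have 2: "a * z * ?b = a"
    using unit_inv_props(1)[OF s] b by (simp add: mult.assoc)
  have "?b \<in> range ((*) a) \<inter> range (\<lambda>z. z * a)" using b by blast
  then show "invertible_along z a"
    unfolding invertible_along_def using 1 2 by (intro exI[of _ ?b]) simp
next
  assume "invertible_along z a"
  then obtain b c where "a = a * z * b" "b = a * c"
    unfolding invertible_along_def by auto
  then show "corner_map a a' z \<in> units"
    using corner_map_unitI_right[OF assms, of z c] by (simp add: mult.assoc)
qed

end

section \<open>Inverses along \<open>a\<close> and hermitian inner inverses\<close>

lemma invertible_along_right_inverse:
  fixes a z b :: "'a::semigroup_mult"
  assumes "invertible_along z a" "a * z * b = a" "b = a * c"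
  shows "b * z * a = a" and "\<exists>d. b = d * a"
proof -
  obtain b0 d where b0: "b0 * z * a = a" "b0 = d * a"
    using assms(1) unfolding invertible_along_def by auto
  \<comment> \<open>Evaluating \<open>b0 * z * b\<close> in two ways identifies \<open>b\<close>
    with the two-sided inverse \<open>b0\<close>.\<close>
  have "b0 * z * b = b" using b0(1) assms(3) by (simp flip: mult.assoc)
  moreover have "b0 * z * b = b0" using b0(2) assms(2) by (simp add: mult.assoc)
  ultimately have "b0 = b" by simp
  then show "b * z * a = a" and "\<exists>d. b = d * a" using b0 by auto
qed

lemma invertible_along_left_inverse:
  fixes a z b :: "'a::semigroup_mult"
  assumes "invertible_along z a" "b * z * a = a" "b = d * a"
  shows "a * z * b = a" and "\<exists>c. b = a * c"
proof -
  obtain b0 c where b0: "a = a * z * b0" "b0 = a * c"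
    using assms(1) unfolding invertible_along_def by auto
  have "b * z * b0 = b" using b0(1) assms(3) by (metis mult.assoc)
  moreover have "b * z * b0 = b0" using b0(2) assms(2) by (metis mult.assoc)
  ultimately have "b0 = b" by simp
  then show "a * z * b = a" and "\<exists>c. b = a * c" using b0 by auto
qed

text \<open>The adjoint of the hypothesis, multiplied by \<open>m\<close>, gives
  \<open>m * a\<^sup>\<star> = a * m\<^sup>\<star>\<close>, and these two elements are adjoint to
  each other.\<close>

lemma hermitian_right:
  fixes a m :: "'a::star_ring"
  assumes "m * a\<^sup>\<star> * a = a"
  shows "(a * m\<^sup>\<star>)\<^sup>\<star> = a * m\<^sup>\<star>" and "a * m\<^sup>\<star> * a = a"
proof -
  have "a\<^sup>\<star> = a\<^sup>\<star> * (a * m\<^sup>\<star>)"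
    using arg_cong[OF assms, of star] by (simp add: star_mult star_star mult.assoc)
  then have "m * a\<^sup>\<star> = m * a\<^sup>\<star> * a * m\<^sup>\<star>" by (metis mult.assoc)
  then have "m * a\<^sup>\<star> = a * m\<^sup>\<star>" using assms by simp
  then show "(a * m\<^sup>\<star>)\<^sup>\<star> = a * m\<^sup>\<star>" and "a * m\<^sup>\<star> * a = a"
    using assms by (simp_all add: star_mult star_star)
qed

lemma hermitian_left:
  fixes a n :: "'a::star_ring"
  assumes "a * a\<^sup>\<star> * n = a"
  shows "(n\<^sup>\<star> * a)\<^sup>\<star> = n\<^sup>\<star> * a" and "a * n\<^sup>\<star> * a = a"
proof -
  have a: "a\<^sup>\<star> = n\<^sup>\<star> * a * a\<^sup>\<star>"
    using arg_cong[OF assms, of star] by (simp add: star_mult star_star mult.assoc)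
  have "n\<^sup>\<star> * a = n\<^sup>\<star> * (a * a\<^sup>\<star> * n)" by (simp only: assms)
  also have "\<dots> = a\<^sup>\<star> * n" using a by (metis mult.assoc)
  finally have na: "n\<^sup>\<star> * a = a\<^sup>\<star> * n" .
  then show "(n\<^sup>\<star> * a)\<^sup>\<star> = n\<^sup>\<star> * a" by (simp add: star_mult star_star)
  show "a * n\<^sup>\<star> * a = a" using na assms by (simp add: mult.assoc)
qed

lemma star_invertible_along_iff_moore_penrose:
  fixes a a' :: "'a::star_ring"
  assumes df: "dedekind_finite TYPE('a)" and inner: "a * a' * a = a"
  shows "invertible_along (a\<^sup>\<star>) a \<longleftrightarrow> moore_penrose_invertible a"
proof
  assume "invertible_along (a\<^sup>\<star>) a"
  then obtain m where m: "m * a\<^sup>\<star> * a = a" "a = a * a\<^sup>\<star> * m"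
    unfolding invertible_along_def by auto
  note h = hermitian_right[OF m(1)] hermitian_left[OF m(2)[symmetric]]
  \<comment> \<open>Sandwiching \<open>a\<close> between two copies of the inner inverse enforces
    \<open>x * a * x = x\<close> and keeps the hermitian products with \<open>a\<close>.\<close>
  let ?x = "m\<^sup>\<star> * a * m\<^sup>\<star>"
  have ax: "a * ?x = a * m\<^sup>\<star>" and xa: "?x * a = m\<^sup>\<star> * a"
    using h(2) by (metis mult.assoc)+
  have "?x * a * ?x = ?x" using h(2) xa by (metis mult.assoc)
  then show "moore_penrose_invertible a"
    unfolding moore_penrose_invertible_def
    using h ax xa by (intro exI[of _ ?x]) simp
next
  assume "moore_penrose_invertible a"
  then obtain x where x: "a * x * a = a" "x * a * x = x"
      "(a * x)\<^sup>\<star> = a * x" "(x * a)\<^sup>\<star> = x * a"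
    unfolding moore_penrose_invertible_def by blast
  \<comment> \<open>Using that \<open>x * a\<close> and then \<open>a * x\<close> is hermitian
    brings \<open>a\<close> into the form \<open>a * z * a * y\<close> with
    \<open>z = a\<^sup>\<star>\<close>.\<close>
  have "a = a * (a\<^sup>\<star> * x\<^sup>\<star>)" using x(1,4) by (simp add: star_mult mult.assoc)
  moreover have "x\<^sup>\<star> = a * x * x\<^sup>\<star>" using x(2,3) by (metis star_mult mult.assoc)
  ultimately have "a = a * a\<^sup>\<star> * a * (x * x\<^sup>\<star>)" by (metis mult.assoc)
  then show "invertible_along (a\<^sup>\<star>) a"
    using corner_map_unitI_right[OF inner df]
      corner_map_units_iff_invertible_along[OF inner df] by blast
qed

section \<open>Core and dual core inverses\<close>

lemma is_core_inverseI:
  fixes a w b g :: "'a::star_ring"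
  assumes "a * w * b = a" "b * w * a = a" "b = a * c" "b = d * a"
    and "a * g * a = a" "(a * g)\<^sup>\<star> = a * g"
  shows "is_core_inverse w a (b * g)"
proof -
  have 1: "a * w * (b * g) = a * g" using assms(1) by (simp flip: mult.assoc)
  \<comment> \<open>Lying in both aR and Ra, \<open>b\<close> absorbs \<open>a * g\<close> on the
    left and \<open>g * a\<close> on the right.\<close>
  have 2: "a * g * b = b" using assms(3,5) by (metis mult.assoc)
  have 3: "b * g * a = b" using assms(4,5) by (metis mult.assoc)
  have "a * w * (b * g)^2 = a * g * b * g" by (simp add: power2_eq_square 1 flip: mult.assoc)
    (simp add: assms(1))
  then show ?thesis
    unfolding is_core_inverse_def using 1 2 3 assms(2,6) by simp
qed

lemma is_dual_core_inverseI:
  fixes a v b g :: "'a::star_ring"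
  assumes "a * v * b = a" "b * v * a = a" "b = a * c" "b = d * a"
    and "a * g * a = a" "(g * a)\<^sup>\<star> = g * a"
  shows "is_dual_core_inverse v a (g * b)"
proof -
  have 1: "g * b * v * a = g * a" using assms(2) by (simp add: mult.assoc)
  have 2: "a * g * b = b" using assms(3,5) by (metis mult.assoc)
  have 3: "b * g * a = b" using assms(4,5) by (metis mult.assoc)
  have "a * v * a * (g * b) = a * v * (a * g * b)" by (simp add: mult.assoc)
  then have 4: "a * v * a * (g * b) = a" using 2 assms(1) by simp
  have "(g * b)^2 * v * a = g * b * (g * b * v * a)" by (simp add: power2_eq_square mult.assoc)
  also have "\<dots> = g * (b * g * a)" by (simp only: 1) (simp only: mult.assoc)
  finally show ?thesis
    unfolding is_dual_core_inverse_def using 1 3 4 assms(6) by simp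
qed

lemma core_and_dual_core_invertible_imp:
  fixes a a' w v :: "'a::star_ring"
  assumes df: "dedekind_finite TYPE('a)" and inner: "a * a' * a = a"
    and "core_invertible w a" "dual_core_invertible v a"
  shows "corner_map a a' w \<in> units" "corner_map a a' v \<in> units"
    "corner_map a a' (a\<^sup>\<star>) \<in> units"
proof -
  obtain x where x: "a * w * x^2 = x" "x * a * w * a = a" "(a * w * x)\<^sup>\<star> = a * w * x"
    using assms(3) unfolding core_invertible_def is_core_inverse_def by blast
  obtain y where y: "a * v * a * y = a" "y^2 * v * a = y" "(y * v * a)\<^sup>\<star> = y * v * a"
    using assms(4) unfolding dual_core_invertible_def is_dual_core_inverse_def by blast
  show "corner_map a a' w \<in> units" "corner_map a a' v \<in> units"
    using corner_map_unitI_left[OF inner df, of x w] x(2)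
      corner_map_unitI_right[OF inner df, of v y] y(1) by simp_all
  \<comment> \<open>The hermitian elements \<open>a * w * x\<close> and \<open>y * v * a\<close> fix
    \<open>a\<close> from the left and from the right; their adjoints produce the two missing
    factors in \<open>a = a * a\<^sup>\<star> * a * _\<close>.\<close>
  have "a * w * x * a = a" using x(1,2) by (metis power2_eq_square mult.assoc)
  then have "a\<^sup>\<star> * (a * w * x) = a\<^sup>\<star>" using x(3) by (metis star_mult)
  moreover have "a * (y * v * a) = a" using y(1,2) by (metis power2_eq_square mult.assoc)
  then have "a * (a\<^sup>\<star> * (y * v)\<^sup>\<star>) = a" using y(3) by (simp add: star_mult)
  ultimately have "a = a * a\<^sup>\<star> * a * (w * x * (y * v)\<^sup>\<star>)" by (metis mult.assoc)
  then show "corner_map a a' (a\<^sup>\<star>) \<in> units" by (rule corner_map_unitI_right[OF inner df])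
qed

lemma core_and_dual_core_inverse_formula:
  fixes a a' w v u s t :: "'a::star_ring"
  assumes df: "dedekind_finite TYPE('a)" and inner: "a * a' * a = a"
    and u_def: "u = a * w * a * v * a * a\<^sup>\<star> + 1 - a * a'"
    and s_def: "s = w * a * v * a * a\<^sup>\<star> * a + 1 - a' * a"
    and t_def: "t = v * a * w * a * a\<^sup>\<star> * a + 1 - a' * a"
    and units: "u \<in> units" "s \<in> units" "t \<in> units"
    and along: "invertible_along w a" "invertible_along v a" "invertible_along (a\<^sup>\<star>) a"
  shows "is_core_inverse w a
      (a * v * a * a\<^sup>\<star> * a * unit_inv s * (unit_inv u * a * w * a * v * a)\<^sup>\<star>)" (is ?core)
    and "is_dual_core_inverse v a
      ((unit_inv u * a * w * a * v * a)\<^sup>\<star> * a * w * a * a\<^sup>\<star> * a * unit_inv t)" (is ?dual)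
proof -
  note ia = inner_assoc[OF inner]
  have ua: "u * a = a * w * a * v * a * a\<^sup>\<star> * a" and as: "a * s = a * w * a * v * a * a\<^sup>\<star> * a"
    and at: "a * t = a * v * a * w * a * a\<^sup>\<star> * a"
    unfolding u_def s_def t_def by (simp_all add: algebra_simps ia)
  let ?m = "unit_inv u * a * w * a * v * a"
  have "?m * a\<^sup>\<star> * a = unit_inv u * (u * a)" by (simp add: ua mult.assoc)
  then have m1: "?m * a\<^sup>\<star> * a = a" using unit_inv_props(2)[OF units(1)] by (simp flip: mult.assoc)
  have m2: "a * a\<^sup>\<star> * ?m = a" by (rule invertible_along_left_inverse(1)[OF along(3) m1 refl])
  note h = hermitian_right[OF m1] hermitian_left[OF m2]
  \<comment> \<open>The inverses of \<open>w\<close> and \<open>v\<close> along \<open>a\<close>,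
    read off from \<open>a * s\<close> and \<open>a * t\<close>. They visibly lie in aR; membership
    in Ra comes from uniqueness.\<close>
  let ?b = "a * v * a * a\<^sup>\<star> * a * unit_inv s" and ?c = "a * w * a * a\<^sup>\<star> * a * unit_inv t"
  have "a * w * ?b = a * s * unit_inv s" by (simp add: as mult.assoc)
  then have b: "a * w * ?b = a" using unit_inv_props(1)[OF units(2)] by (simp add: mult.assoc)
  have b': "?b = a * (v * a * a\<^sup>\<star> * a * unit_inv s)" by (simp add: mult.assoc)
  have "a * v * ?c = a * t * unit_inv t" by (simp add: at mult.assoc)
  then have c: "a * v * ?c = a" using unit_inv_props(1)[OF units(3)] by (simp add: mult.assoc)
  have c': "?c = a * (w * a * a\<^sup>\<star> * a * unit_inv t)" by (simp add: mult.assoc)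
  obtain d e where de: "?b = d * a" "?c = e * a"
    using invertible_along_right_inverse(2)[OF along(1) b b']
      invertible_along_right_inverse(2)[OF along(2) c c'] by blast
  show ?core
    by (rule is_core_inverseI[OF b invertible_along_right_inverse(1)[OF along(1) b b'] b' de(1)
          h(2) h(1)])
  have "is_dual_core_inverse v a (?m\<^sup>\<star> * ?c)"
    by (rule is_dual_core_inverseI[OF c invertible_along_right_inverse(1)[OF along(2) c c'] c' de(2)
          h(2) h(3)])
  then show ?dual by (simp only: mult.assoc)
qed

theorem theorem3p9:
  fixes a w v a' u r s t :: "'a::star_ring"
  assumes "dedekind_finite TYPE('a)"
    and "regular a"
    and "is_inner_inverse a a'"
    and "u = a * w * a * v * a * a\<^sup>\<star> + 1 - a * a'"
    and "r = a * v * a * w * a * a\<^sup>\<star> + 1 - a * a'"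
    and "s = w * a * v * a * a\<^sup>\<star> * a + 1 - a' * a"
    and "t = v * a * w * a * a\<^sup>\<star> * a + 1 - a' * a"
  shows
    "(core_invertible w a \<and> dual_core_invertible v a
        \<longleftrightarrow> invertible_along (w * a * v) a \<and> moore_penrose_invertible a) \<and>
     (core_invertible w a \<and> dual_core_invertible v a
        \<longleftrightarrow> invertible_along (v * a * w) a \<and> moore_penrose_invertible a) \<and>
     (core_invertible w a \<and> dual_core_invertible v a \<longleftrightarrow> u \<in> units) \<and>
     (core_invertible w a \<and> dual_core_invertible v a \<longleftrightarrow> r \<in> units) \<and>
     (core_invertible w a \<and> dual_core_invertible v a \<longleftrightarrow> s \<in> units) \<and>
     (core_invertible w a \<and> dual_core_invertible v a \<longleftrightarrow> t \<in> units) \<and>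
     (core_invertible w a \<and> dual_core_invertible v a \<longrightarrow>
        core_inverse w a =
          a * v * a * a\<^sup>\<star> * a * unit_inv s * (unit_inv u * a * w * a * v * a)\<^sup>\<star> \<and>
        dual_core_inverse v a =
          (unit_inv u * a * w * a * v * a)\<^sup>\<star> * a * w * a * a\<^sup>\<star> * a * unit_inv t)"
proof -
  note df = assms(1)
  have inner: "a * a' * a = a" using assms(3) unfolding is_inner_inverse_def .
  let ?\<phi> = "corner_map a a'"
  let ?Q = "?\<phi> w \<in> units \<and> ?\<phi> v \<in> units \<and> ?\<phi> (a\<^sup>\<star>) \<in> units"
  \<comment> \<open>Read from right to left, multiplicativity splits \<open>?\<phi>\<close> at
    \<open>w * a * v\<close> into \<open>?\<phi> w * ?\<phi> v\<close>, and likewise for longer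
    products.\<close>
  note mult = corner_map_mult[OF inner, symmetric] dedekind_finite_mult_units_iff[OF df]
  note along = corner_map_units_iff_invertible_along[OF inner df, symmetric]
  note mp = star_invertible_along_iff_moore_penrose[OF df inner, symmetric]
  have ii: "invertible_along (w * a * v) a \<and> moore_penrose_invertible a \<longleftrightarrow> ?Q"
    and iii: "invertible_along (v * a * w) a \<and> moore_penrose_invertible a \<longleftrightarrow> ?Q"
    unfolding mp along mult by blast+
  have vi: "s \<in> units \<longleftrightarrow> ?Q"
    using corner_map_units_iff[OF inner, of "w * a * v * a * a\<^sup>\<star>"] assms(6) unfolding mult by simp
  have vii: "t \<in> units \<longleftrightarrow> ?Q"
    using corner_map_units_iff[OF inner, of "v * a * w * a * a\<^sup>\<star>"] assms(7) unfolding mult by auto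
  have iv: "u \<in> units \<longleftrightarrow> ?Q"
    using units_row_column_iff[OF inner, of "w * a * v * a * a\<^sup>\<star>"] vi assms(4,6)
    by (simp add: mult.assoc)
  have v: "r \<in> units \<longleftrightarrow> ?Q"
    using units_row_column_iff[OF inner, of "v * a * w * a * a\<^sup>\<star>"] vii assms(5,7)
    by (simp add: mult.assoc)
  have formula: "is_core_inverse w a
        (a * v * a * a\<^sup>\<star> * a * unit_inv s * (unit_inv u * a * w * a * v * a)\<^sup>\<star>) \<and>
      is_dual_core_inverse v a
        ((unit_inv u * a * w * a * v * a)\<^sup>\<star> * a * w * a * a\<^sup>\<star> * a * unit_inv t)" if ?Q
    using core_and_dual_core_inverse_formula[OF df inner assms(4,6,7)] that iv vi vii
    unfolding along by blast
  \<comment> \<open>The explicit formulas serve as existence witnesses for the converse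
    direction.\<close>
  have i: "core_invertible w a \<and> dual_core_invertible v a \<longleftrightarrow> ?Q"
    using formula core_and_dual_core_invertible_imp[OF df inner]
    unfolding core_invertible_def dual_core_invertible_def by blast
  show ?thesis
    unfolding i ii iii iv v vi vii
    using formula core_inverse_eqI dual_core_inverse_eqI by blast
qed

end
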